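(* Let $V\in\mathrm{U}(d,\mathbb{C})$ be a unitary matrix that is not real-valued, and let $\mathcal{R}_V\in\mathrm{Sp}(2d,\mathbb{R})$ be the associated symplectic matrix. Let $\Omega=\Omega(V)\in\mathrm{GL}(2d,\mathbb{R})$ be a matrix which, together with some index $1\le k\le d$ and some $\mathcal{B}\in\mathrm{Sp}(2d,\mathbb{R})$, gives the factorization $$|u|\otimes|\widehat{\mathcal{R}_V}u|=\widehat{\mathcal{D}_\Omega}\big(|\widehat{\mathcal{B}}u|\otimes|\mathcal{F}_k\widehat{\mathcal{B}}u|\big)\quad\text{for all }u\in L^2(\mathbb{R}^d).$$ If $f\in L^2(\mathbb{R}^d)$ satisfies $$|(f\otimes\widehat{\mathcal{R}_V}f)(\lambda)|\le c\,\exp\left(-\pi\left|\Omega^{-1}\lambda\cdot\mathrm{diag}(\alpha I_d,\beta I_d)\,\Omega^{-1}\lambda\right|\right)\quad\text{for a.a. }\lambda\in\mathbb{R}^{2d}$$ for some $\alpha,\beta,c>0$ with $\alpha\beta>1$, then $f\equiv0$.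
   Context: $f\equiv 0$ means zero a.e.; $(f\otimes g)(x,y)=f(x)g(y)$ for $x,y\in\mathbb{R}^d$. $\mathrm{Sp}(2d,\mathbb{R})=\{M\in\mathbb{R}^{2d\times 2d}: M^t\mathcal{J}M=\mathcal{J}\}$, $\mathcal{J}=\begin{pmatrix}0&I\\-I&0\end{pmatrix}$. For $(x,\omega)\in\mathbb{R}^d\times\mathbb{R}^d$, $\rho(x,\omega)f(t)=e^{-\pi i x\cdot\omega}e^{2\pi i\omega\cdot t}f(t-x)$. For $M\in\mathrm{Sp}(2d,\mathbb{R})$, $\widehat{M}$ denotes an associated metaplectic operator: a unitary operator on $L^2(\mathbb{R}^d)$ with $\rho(M\lambda)=\widehat M\rho(\lambda)\widehat M^{-1}$ for all $\lambda\in\mathbb{R}^{2d}$; it is unique up to a factor of modulus 1 (irrelevant here, since only absolute values occur). For a unitary matrix $V=A+iB$ with real part $A$ and imaginary part $B$, $\mathcal{R}_V=\begin{pmatrix}A&B\\-B&A\end{pmatrix}$. For $L\in\mathrm{GL}(n,\mathbb{R})$, $\widehat{\mathcal{D}_L}F(x)=|\det L|^{-1/2}F(L^{-1}x)$ on functions on $\mathbb{R}^n$. For $1\le k\le d$, the partial Fourier transform is $\mathcal{F}_kf(\omega_1,\omega_2)=\int_{\mathbb{R}^k}f(x_1,\omega_2)e^{-2\pi i\omega_1\cdot x_1}\,dx_1$, $(\omega_1,\omega_2)\in\mathbb{R}^k\times\mathbb{R}^{d-k}$, extended to a unitary operator on $L^2(\mathbb{R}^d)$ ($\mathcal{F}_d=\mathcal{F}$).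 Data $k,\mathcal{B},\Omega$ giving the factorization in the claim exist whenever $V$ is not real-valued. *)

theory Defs
  imports "HOL-Analysis.Analysis"
begin

(* Elements of L^2(R^n) are represented by Borel measurable functions (every class has
   such a representative), so equality in L^2 is ae_eq and operators on L^2 are maps on
   representatives that respect ae_eq. *)

definition L2 :: "(real^'n \<Rightarrow> complex) set" where
  "L2 = {f. f \<in> borel_measurable lborel \<and> integrable lborel (\<lambda>x. (cmod (f x))\<^sup>2)}"

definition ae_eq :: "(real^'n \<Rightarrow> 'b) \<Rightarrow> (real^'n \<Rightarrow> 'b) \<Rightarrow> bool" where
  "ae_eq f g \<longleftrightarrow> (AE x in lborel. f x = g x)"

definition L2_inner :: "(real^'n \<Rightarrow> complex) \<Rightarrow> (real^'n \<Rightarrow> complex) \<Rightarrow> complex" where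
  "L2_inner f g = (\<integral>x. f x * cnj (g x) \<partial>lborel)"

definition unitary_on_L2 :: "((real^'n \<Rightarrow> complex) \<Rightarrow> (real^'n \<Rightarrow> complex)) \<Rightarrow> bool" where
  "unitary_on_L2 T \<longleftrightarrow>
     (\<forall>f\<in>L2. T f \<in> L2) \<and>
     (\<forall>f\<in>L2. \<forall>g\<in>L2. ae_eq f g \<longrightarrow> ae_eq (T f) (T g)) \<and>
     (\<forall>f\<in>L2. \<forall>g\<in>L2. ae_eq (T (\<lambda>x. f x + g x)) (\<lambda>x. T f x + T g x)) \<and>
     (\<forall>f\<in>L2. \<forall>a. ae_eq (T (\<lambda>x. a * f x)) (\<lambda>x. a * T f x)) \<and>
     (\<forall>f\<in>L2. \<forall>g\<in>L2. L2_inner (T f) (T g) = L2_inner f g) \<and>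
     (\<forall>g\<in>L2. \<exists>f\<in>L2. ae_eq (T f) g)"

(* R^{2d} is real^('d + 'd): Inl indexes the first d coordinates, Inr the last d. *)

definition upper_half :: "real^('d + 'd) \<Rightarrow> real^'d" where
  "upper_half z = (\<chi> i. z $ Inl i)"

definition lower_half :: "real^('d + 'd) \<Rightarrow> real^'d" where
  "lower_half z = (\<chi> i. z $ Inr i)"

definition block_matrix ::
  "real^'d^'d \<Rightarrow> real^'d^'d \<Rightarrow> real^'d^'d \<Rightarrow> real^'d^'d \<Rightarrow> real^('d + 'd)^('d + 'd)" where
  "block_matrix A B C D = (\<chi> i j. case i of
       Inl p \<Rightarrow> (case j of Inl q \<Rightarrow> A $ p $ q | Inr q \<Rightarrow> B $ p $ q)
     | Inr p \<Rightarrow> (case j of Inl q \<Rightarrow> C $ p $ q | Inr q \<Rightarrow> D $ p $ q))"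

definition symplectic_J :: "real^('d::finite + 'd)^('d + 'd)" where
  "symplectic_J = block_matrix 0 (mat 1) (- mat 1) 0"

definition Sp :: "(real^('d::finite + 'd)^('d + 'd)) set" where
  "Sp = {M. transpose M ** symplectic_J ** M = symplectic_J}"

definition tensor :: "(real^'d \<Rightarrow> 'b::times) \<Rightarrow> (real^'d \<Rightarrow> 'b) \<Rightarrow> real^('d + 'd) \<Rightarrow> 'b" where
  "tensor f g z = f (upper_half z) * g (lower_half z)"

definition dilation :: "real^'n^'n \<Rightarrow> (real^'n \<Rightarrow> 'b::real_vector) \<Rightarrow> real^'n \<Rightarrow> 'b" where
  "dilation L F x = (\<bar>det L\<bar> powr (- 1 / 2)) *\<^sub>R F (matrix_inv L *v x)"

definition rho :: "real^('d + 'd) \<Rightarrow> (real^'d \<Rightarrow> complex) \<Rightarrow> real^'d \<Rightarrow> complex" where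
  "rho z f t = (let x = upper_half z; w = lower_half z in
     exp (- pi * \<i> * complex_of_real (x \<bullet> w)) *
     exp (2 * pi * \<i> * complex_of_real (w \<bullet> t)) * f (t - x))"

(* The intertwining relation rho(M z) = T rho(z) T^{-1}, composed with T on the right. *)
definition metaplectic ::
  "real^('d + 'd)^('d + 'd) \<Rightarrow> ((real^'d \<Rightarrow> complex) \<Rightarrow> (real^'d \<Rightarrow> complex)) \<Rightarrow> bool" where
  "metaplectic M T \<longleftrightarrow> unitary_on_L2 T \<and>
     (\<forall>z. \<forall>f\<in>L2. ae_eq (rho (M *v z) (T f)) (T (rho z f)))"

definition unitary_matrix :: "complex^'d^'d \<Rightarrow> bool" where
  "unitary_matrix V \<longleftrightarrow>
     (let V' = (\<chi> i j. cnj (V $ j $ i)) in V ** V' = mat 1 \<and> V' ** V = mat 1)"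

definition real_valued_matrix :: "complex^'d^'d \<Rightarrow> bool" where
  "real_valued_matrix V \<longleftrightarrow> (\<forall>i j. V $ i $ j \<in> \<real>)"

definition R_mat :: "complex^'d^'d \<Rightarrow> real^('d + 'd)^('d + 'd)" where
  "R_mat V = (let A = (\<chi> i j. Re (V $ i $ j)); B = (\<chi> i j. Im (V $ i $ j))
              in block_matrix A B (- B) A)"

(* The linear order on the index type says which k coordinates come first. *)
definition first_coords :: "nat \<Rightarrow> 'd::{finite,linorder} set" where
  "first_coords k = {i. card {j. j < i} < k}"

(* R^k is the set of functions on the first k indices, with Lebesgue measure as the
   product measure; w carries both w1 (first k coordinates) and w2 (the remaining ones). *)
definition partial_fourier_integral ::
  "nat \<Rightarrow> (real^('d::{finite,linorder}) \<Rightarrow> complex) \<Rightarrow> real^('d::{finite,linorder}) \<Rightarrow> complex" where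
  "partial_fourier_integral k f w =
     (\<integral>x. f (\<chi> i. if i \<in> first_coords k then x i else w $ i) *
           exp (- 2 * pi * \<i> * complex_of_real (\<Sum>i\<in>first_coords k. w $ i * x i))
        \<partial>(Pi\<^sub>M (first_coords k) (\<lambda>_. lborel)))"

(* T is the extension of the integral, defined for f in both L^1 and L^2, to a unitary
   operator on L^2; by density of that subspace T is unique up to null sets. *)
definition partial_fourier ::
  "nat \<Rightarrow> ((real^('d::{finite,linorder}) \<Rightarrow> complex) \<Rightarrow> (real^('d::{finite,linorder}) \<Rightarrow> complex)) \<Rightarrow> bool" where
  "partial_fourier k T \<longleftrightarrow> unitary_on_L2 T \<and>
     (\<forall>f\<in>L2. integrable lborel f \<longrightarrow> ae_eq (T f) (partial_fourier_integral k f))"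

end

theory Submission
  imports
    Defs
    "HOL-Complex_Analysis.Conformal_Mappings"
    "HOL-Probability.Distributions"
    "HOL-Real_Asymp.Real_Asymp"
begin

text \<open>
  Put \<open>g = B_hat f\<close> and \<open>h = F_k g\<close>. Applied to \<open>f\<close> itself, the factorization turns the decay
  hypothesis, after the substitution \<open>z = \<Omega> y\<close>, into
  \<open>\<bar>g x\<bar> \<bar>h y\<bar> \<le> K exp (- \<pi> \<alpha> \<bar>x\<bar>\<^sup>2) exp (- \<pi> \<beta> \<bar>y\<bar>\<^sup>2)\<close> for almost all \<open>(x, y)\<close>. If \<open>f\<close> were not
  null, then by unitarity neither would \<open>g\<close> or \<open>h\<close> be; freezing one variable at a point where the
  corresponding factor does not vanish gives \<open>g\<close> Gaussian decay of rate \<open>\<alpha>\<close> and its partial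
  Fourier transform \<open>h\<close> Gaussian decay of rate \<open>\<beta>\<close>. So everything rests on a Hardy uncertainty
  principle for the partial Fourier transform, \<open>Hardy_partial_fourier\<close>.

  That principle reduces to one variable without any induction on \<open>k\<close>. Fix all coordinates of
  its argument \<open>w\<close> except one transformed coordinate \<open>w\<^sub>j = s\<close>; as a function of \<open>s\<close> the partial transform is
  \<open>F s = \<integral> G x exp (- 2 \<pi> i s x\<^sub>j) dx\<close>, where \<open>G\<close> has absorbed the other coordinates of \<open>w\<close> and is still
  dominated by a Gaussian. Then \<open>F\<close> extends to an entire function (\<open>bilateral_Laplace_entire\<close>) with
  \<open>\<bar>F (x + i y)\<bar> \<le> A exp (\<pi> y\<^sup>2 / \<alpha>)\<close>, while \<open>\<bar>F s\<bar> \<le> A exp (- \<pi> \<beta> s\<^sup>2)\<close> on the real line. Since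
  \<open>1 / \<alpha> < \<beta>\<close>, the two bounds are incompatible unless \<open>F = 0\<close> (\<open>entire_gaussian_decay_eq_0\<close>): for
  every \<open>t\<close> the function \<open>F z exp (\<pi> (\<beta> - i t) z\<^sup>2)\<close> is bounded by \<open>A\<close> on both edges of a sector that
  approaches the open first quadrant, hence inside by the Phragmen-Lindelof principle, and
  \<open>t \<rightarrow> \<infinity>\<close> forces \<open>F\<close> to vanish on the quadrant. Thus the partial transform vanishes on almost every
  line in direction \<open>j\<close>, so \<open>h\<close> is null, a contradiction.
\<close>

section \<open>A Phragmen-Lindelof principle and entire functions with Gaussian decay\<close>

definition sector :: "real \<Rightarrow> complex set" where
  "sector \<tau> = {z. \<bar>Im z\<bar> \<le> \<tau> * Re z}"

text \<open>
  A sector with \<open>\<tau> < 1\<close> has opening angle below \<open>\<pi> / 2\<close>, which leaves room for an exponent \<open>p > 2\<close>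
  such that \<open>z powr p\<close> still maps the sector into a cone strictly inside the right half plane. So
  \<open>exp (- \<epsilon> z powr p)\<close> beats every growth of order 2. The shift by 1 keeps the branch point of the
  logarithm away from the vertex of the sector.
\<close>

lemma sector_power_Re_lower_bound:
  assumes "0 < \<tau>" "\<tau> < 1"
  obtains p \<delta> :: real where "2 < p" "0 < \<delta>"
    "\<And>z. z \<in> sector \<tau> \<Longrightarrow> \<delta> * cmod (z + 1) powr p \<le> Re (exp (of_real p * Ln (z + 1)))"
proof -
  define \<phi> where "\<phi> = arctan \<tau>"
  have \<phi>: "0 < \<phi>" "\<phi> < pi / 4"
    using assms arctan_less_iff[of 0 \<tau>] arctan_less_iff[of \<tau> 1] by (auto simp: \<phi>_def arctan_one)
  \<comment> \<open>any exponent between 2 and \<open>\<pi> / (2 \<phi>)\<close> would do; this is the mean of the two\<close>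
  define p where "p = 1 + pi / (4 * \<phi>)"
  have p: "2 < p" "p * \<phi> < pi / 2"
    using \<phi> by (auto simp: p_def field_simps)
  have "0 < cos (p * \<phi>)"
    using \<phi> p by (intro cos_gt_zero) auto
  moreover have "cos (p * \<phi>) * cmod (z + 1) powr p \<le> Re (exp (of_real p * Ln (z + 1)))"
    if z: "z \<in> sector \<tau>" for z
  proof -
    have "0 \<le> \<tau> * Re z"
      using z unfolding sector_def by (smt (verit) mem_Collect_eq abs_ge_zero)
    then have re: "0 \<le> Re z"
      using assms(1) by (simp add: zero_le_mult_iff)
    then have nz: "z + 1 \<noteq> 0"
      by (auto simp: complex_eq_iff)
    have "\<bar>Im z\<bar> \<le> \<tau> * (1 + Re z)"
      using z assms(1) by (simp add: sector_def distrib_left)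
    then have "\<bar>Im (z + 1) / Re (z + 1)\<bar> \<le> \<tau>"
      using re by (simp add: abs_divide pos_divide_le_eq add.commute)
    then have "Im (z + 1) / Re (z + 1) \<le> \<tau>" "- (Im (z + 1) / Re (z + 1)) \<le> \<tau>"
      unfolding abs_le_iff by auto
    then have "\<bar>arctan (Im (z + 1) / Re (z + 1))\<bar> \<le> \<phi>"
      unfolding abs_le_iff \<phi>_def arctan_minus[symmetric] arctan_le_iff by auto
    then have arg: "\<bar>Im (Ln (z + 1))\<bar> \<le> \<phi>"
      using re nz by (subst Im_Ln_eq) auto
    have "cos (p * \<phi>) \<le> cos \<bar>p * Im (Ln (z + 1))\<bar>"
      using arg p \<phi> by (intro cos_monotone_0_pi_le) (auto simp: abs_mult)
    moreover have "exp (p * ln (cmod (z + 1))) = cmod (z + 1) powr p"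
      using nz by (simp add: powr_def)
    ultimately show ?thesis
      using nz by (simp add: Re_exp mult.commute mult_left_mono)
  qed
  ultimately show thesis
    using that p by blast
qed

lemma sector_boundary:
  assumes "z \<in> frontier (sector \<tau> \<inter> cball 0 R)"
  shows "z \<in> sector \<tau>" "\<bar>Im z\<bar> = \<tau> * Re z \<or> cmod z = R"
proof -
  have cl: "closed (sector \<tau>)"
    unfolding sector_def by (intro closed_Collect_le continuous_intros)
  have "open {z. \<bar>Im z\<bar> < \<tau> * Re z}"
    by (intro open_Collect_less continuous_intros)
  then have "{z. \<bar>Im z\<bar> < \<tau> * Re z} \<inter> ball 0 R \<subseteq> interior (sector \<tau> \<inter> cball 0 R)"
    by (intro interior_maximal) (auto simp: sector_def)
  moreover have "z \<in> sector \<tau> \<inter> cball 0 R"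
    using assms cl by (metis closed_Int closed_cball frontier_subset_closed subsetD)
  moreover have "z \<notin> interior (sector \<tau> \<inter> cball 0 R)"
    using assms by (simp add: frontier_def)
  ultimately have "z \<in> sector \<tau> \<inter> cball 0 R" "\<not> (\<bar>Im z\<bar> < \<tau> * Re z \<and> cmod z < R)"
    by auto
  then show "z \<in> sector \<tau>" "\<bar>Im z\<bar> = \<tau> * Re z \<or> cmod z = R"
    unfolding sector_def by auto
qed

text \<open>
  Damp by \<open>exp (- \<epsilon> (z + 1) powr p)\<close>, apply the maximum modulus principle on a truncated sector whose
  arc is so far out that the damping has taken over, and let \<open>\<epsilon> \<rightarrow> 0\<close>.
\<close>

lemma Phragmen_Lindelof_sector:
  assumes \<tau>: "0 < \<tau>" "\<tau> < 1" and hol: "G holomorphic_on UNIV" and C: "0 < C"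
    and growth: "\<And>z. z \<in> sector \<tau> \<Longrightarrow> cmod (G z) \<le> A * exp (K * (cmod z)\<^sup>2)"
    and rays: "\<And>z. \<bar>Im z\<bar> = \<tau> * Re z \<Longrightarrow> cmod (G z) \<le> C"
    and z: "z \<in> sector \<tau>"
  shows "cmod (G z) \<le> C"
proof -
  obtain p \<delta> :: real where p: "2 < p" and \<delta>: "0 < \<delta>"
    and low: "\<And>z. z \<in> sector \<tau> \<Longrightarrow> \<delta> * cmod (z + 1) powr p \<le> Re (exp (of_real p * Ln (z + 1)))"
    using sector_power_Re_lower_bound[OF \<tau>] by metis
  have re: "0 \<le> Re z" if "z \<in> sector \<tau>" for z
    using that \<tau>(1) unfolding sector_def
    by (smt (verit) mem_Collect_eq zero_le_mult_iff)
  define P where "P = (\<lambda>z. exp (of_real p * Ln (z + 1)))"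
  have damped: "cmod (G z * exp (- of_real \<epsilon> * P z)) \<le> C" if "0 < \<epsilon>" for \<epsilon>
  proof -
    have "((\<lambda>R. A * exp (K * R\<^sup>2 - \<epsilon> * \<delta> * R powr p)) \<longlongrightarrow> 0) at_top"
      using p \<delta> that by real_asymp
    then have "eventually (\<lambda>R. A * exp (K * R\<^sup>2 - \<epsilon> * \<delta> * R powr p) < C) at_top"
      using C by (rule order_tendstoD)
    then have "eventually (\<lambda>R. A * exp (K * R\<^sup>2 - \<epsilon> * \<delta> * R powr p) < C \<and> 0 < R \<and> cmod z < R) at_top"
      by (intro eventually_conj eventually_gt_at_top)
    then obtain R where R: "A * exp (K * R\<^sup>2 - \<epsilon> * \<delta> * R powr p) < C" "0 < R" "cmod z < R"
      using eventually_happens[of _ "at_top :: real filter"] by auto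
    let ?S = "sector \<tau> \<inter> cball 0 R"
    have clos: "closed ?S"
      unfolding sector_def by (intro closed_Int closed_Collect_le continuous_intros) auto
    have "(\<lambda>z. G z * exp (- of_real \<epsilon> * P z)) holomorphic_on ?S"
      unfolding P_def using re
      by (intro holomorphic_intros holomorphic_on_subset[OF hol])
         (force simp: complex_nonpos_Reals_iff)+
    then have hol': "(\<lambda>z. G z * exp (- of_real \<epsilon> * P z)) holomorphic_on interior ?S"
      and cont: "continuous_on (closure ?S) (\<lambda>z. G z * exp (- of_real \<epsilon> * P z))"
      using holomorphic_on_subset[OF _ interior_subset] closure_closed[OF clos]
        holomorphic_on_imp_continuous_on by (blast, metis)
    show ?thesis
    proof (rule maximum_modulus_frontier[OF hol' cont])
      show "bounded ?S" by auto
      show "z \<in> ?S" using z R by auto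
      fix w assume "w \<in> frontier ?S"
      note w = sector_boundary[OF this]
      have Pw: "\<delta> * cmod (w + 1) powr p \<le> Re (P w)"
        using low w unfolding P_def by blast
      show "cmod (G w * exp (- of_real \<epsilon> * P w)) \<le> C"
        using w(2)
      proof
        assume "\<bar>Im w\<bar> = \<tau> * Re w"
        then have "cmod (G w) \<le> C" by (rule rays)
        moreover have "0 \<le> Re (P w)"
          using Pw \<delta> by (smt (verit) mult_nonneg_nonneg powr_ge_zero)
        ultimately show ?thesis
          using that C by (simp add: norm_mult)
            (smt (verit) mult_left_le exp_le_one_iff mult_nonneg_nonneg norm_ge_zero)
      next
        assume wR: "cmod w = R"
        have "cmod w \<le> cmod (w + 1)"
          using re[OF w(1)] by (simp add: cmod_def power2_eq_square algebra_simps)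
        then have "R powr p \<le> cmod (w + 1) powr p"
          using wR R p by (intro powr_mono2) auto
        then have "\<delta> * R powr p \<le> Re (P w)"
          using Pw \<delta> by (smt (verit) mult_left_mono)
        then have "\<epsilon> * \<delta> * R powr p \<le> \<epsilon> * Re (P w)"
          using that by (simp add: mult.assoc)
        then have "cmod (G w * exp (- of_real \<epsilon> * P w)) \<le>
            A * exp (K * R\<^sup>2) * exp (- (\<epsilon> * \<delta> * R powr p))"
          using growth[OF w(1)] wR
          by (simp add: norm_mult, intro mult_mono) (auto intro: order_trans[OF norm_ge_zero])
        also have "\<dots> = A * exp (K * R\<^sup>2 - \<epsilon> * \<delta> * R powr p)"
          by (simp add: exp_diff exp_minus divide_inverse)
        finally show ?thesis using R by simp
      qed
    qed
  qed
  have "((\<lambda>\<epsilon>. cmod (G z * exp (- of_real \<epsilon> * P z))) \<longlongrightarrow> cmod (G z * exp (- of_real 0 * P z))) (at_right 0)"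
    by (intro tendsto_intros)
  moreover have "eventually (\<lambda>\<epsilon>. cmod (G z * exp (- of_real \<epsilon> * P z)) \<le> C) (at_right 0)"
    using damped by (auto simp: eventually_at_right_less intro: eventually_at_rightI[of 0 1])
  ultimately show ?thesis
    using tendsto_upperbound by fastforce
qed

text \<open>
  Along the ray at angle \<open>\<theta>\<close> the growth bound has exponent \<open>\<pi> a r\<^sup>2 sin\<^sup>2 \<theta>\<close>, which at \<open>\<theta> = \<pi> / 2\<close> is
  \<open>\<pi> a r\<^sup>2\<close>. The function \<open>exp (- \<pi> (\<beta> - i t) z\<^sup>2)\<close> has modulus \<open>exp (- \<pi> \<beta> r\<^sup>2)\<close> on the real axis and
  \<open>exp (\<pi> \<beta> r\<^sup>2)\<close> on the imaginary axis, for every \<open>t\<close>. As \<open>a < \<beta>\<close>, a constant multiple of it dominates \<open>F\<close> on both edges of any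
  sector close enough to the quadrant, hence inside; there its modulus tends to 0 as \<open>t \<rightarrow> \<infinity>\<close>.
\<close>

lemma entire_gaussian_decay_eq_0:
  assumes hol: "F holomorphic_on UNIV" and ab: "a < \<beta>" and A: "0 < A"
    and growth: "\<And>z. cmod (F z) \<le> A * exp (pi * a * (Im z)\<^sup>2)"
    and decay: "\<And>x :: real. cmod (F (of_real x)) \<le> A * exp (- pi * \<beta> * x\<^sup>2)"
  shows "F z = 0"
proof -
  have quadrant: "F z = 0" if z: "0 < Re z" "0 < Im z" for z
  proof -
    have bound: "cmod (F z) \<le> A * exp (- pi * (\<beta> * ((Re z)\<^sup>2 - (Im z)\<^sup>2) + 2 * t * Re z * Im z))" for t :: real
    proof -
      \<comment> \<open>with \<open>v = r (1 + i \<tau>)\<^sup>2\<close> on the upper edge, \<open>r\<^sup>2 E \<tau>\<close> is \<open>a (Im v)\<^sup>2 + \<beta> ((Re v)\<^sup>2 - (Im v)\<^sup>2) + 2 t Re v Im v\<close>\<close>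
      define E where "E = (\<lambda>\<tau>::real. 4 * (a - \<beta>) * \<tau>\<^sup>2 + \<beta> * (1 - \<tau>\<^sup>2)\<^sup>2 + 4 * t * \<tau> * (1 - \<tau>\<^sup>2))"
      have "(E \<longlongrightarrow> E 1) (at_left 1)"
        unfolding E_def by (intro tendsto_intros)
      then have 1: "eventually (\<lambda>\<tau>. E \<tau> < 0) (at_left 1)"
        using ab by (intro order_tendstoD(2)[of _ "E 1"]) (auto simp: E_def)
      \<comment> \<open>\<open>z\<close> must lie below the ray through \<open>(1 + i \<tau>)\<^sup>2\<close>, the upper edge of the sector\<close>
      have "((\<lambda>\<tau>. Im z * (1 - \<tau>\<^sup>2) - 2 * \<tau> * Re z) \<longlongrightarrow> Im z * (1 - 1\<^sup>2) - 2 * 1 * Re z) (at_left (1::real))"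
        by (intro tendsto_intros)
      then have 2: "eventually (\<lambda>\<tau>. Im z * (1 - \<tau>\<^sup>2) - 2 * \<tau> * Re z < 0) (at_left 1)"
        using z by (intro order_tendstoD(2)) auto
      have 3: "eventually (\<lambda>\<tau>. \<tau> \<in> {0<..<1::real}) (at_left 1)"
        by (rule eventually_at_leftI[of 0]) auto
      obtain \<tau> where \<tau>: "E \<tau> < 0" "Im z * (1 - \<tau>\<^sup>2) - 2 * \<tau> * Re z < 0" "0 < \<tau>" "\<tau> < 1"
        using eventually_happens[OF eventually_conj[OF 1 eventually_conj[OF 2 3]]] by auto
      \<comment> \<open>multiplication by \<open>u\<close> turns the sector so that its lower edge becomes the positive real axis\<close>
      define u where "u = Complex 1 \<tau>"
      have u: "u \<noteq> 0" by (simp add: u_def complex_eq_iff)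
      define q where "q = of_real \<beta> - \<i> * of_real t"
      define G where "G = (\<lambda>w. F (u * w) * exp (of_real pi * q * (u * w)\<^sup>2))"
      have Re_q: "Re (of_real pi * q * v\<^sup>2) = pi * (\<beta> * ((Re v)\<^sup>2 - (Im v)\<^sup>2) + 2 * t * Re v * Im v)" for v
        by (simp add: q_def power2_eq_square algebra_simps)
      have cmod_G: "cmod (G w) = cmod (F (u * w)) * exp (pi * (\<beta> * ((Re (u*w))\<^sup>2 - (Im (u*w))\<^sup>2) + 2 * t * Re (u*w) * Im (u*w)))" for w
        unfolding G_def norm_mult norm_exp_eq_Re Re_q ..
      have "cmod (G (z / u)) \<le> A"
      proof (rule Phragmen_Lindelof_sector[where G = G and z = "z / u", OF \<tau>(3,4) _ A])
        have "(F \<circ> (\<lambda>w. u * w)) holomorphic_on UNIV"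
          by (intro holomorphic_on_compose holomorphic_intros holomorphic_on_subset[OF hol]) auto
        then show "G holomorphic_on UNIV"
          unfolding G_def o_def by (intro holomorphic_intros)
        show "cmod (G w) \<le> A * exp ((pi * (\<bar>a\<bar> + cmod q) * (cmod u)\<^sup>2) * (cmod w)\<^sup>2)" for w
        proof -
          have "a * (Im (u * w))\<^sup>2 \<le> \<bar>a\<bar> * (cmod (u * w))\<^sup>2"
            using abs_Im_le_cmod[of "u * w"]
            by (intro mult_mono) (auto simp: power2_le_iff_abs_le)
          then have F: "cmod (F (u * w)) \<le> A * exp (pi * \<bar>a\<bar> * (cmod (u * w))\<^sup>2)"
            using growth[of "u * w"] A
            by (elim order_trans) (simp add: mult.assoc)
          have "Re (of_real pi * q * (u * w)\<^sup>2) \<le> pi * cmod q * (cmod (u * w))\<^sup>2"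
            using complex_Re_le_cmod[of "of_real pi * q * (u * w)\<^sup>2"]
            by (simp add: norm_mult norm_power)
          then have "cmod (G w) \<le> A * exp (pi * \<bar>a\<bar> * (cmod (u * w))\<^sup>2) * exp (pi * cmod q * (cmod (u * w))\<^sup>2)"
            unfolding G_def norm_mult norm_exp_eq_Re
            using F A by (intro mult_mono) (auto simp: norm_mult)
          also have "\<dots> = A * exp ((pi * (\<bar>a\<bar> + cmod q) * (cmod u)\<^sup>2) * (cmod w)\<^sup>2)"
            by (simp add: norm_mult power_mult_distrib algebra_simps flip: exp_add)
          finally show ?thesis .
        qed
        show "cmod (G w) \<le> A" if w: "\<bar>Im w\<bar> = \<tau> * Re w" for w
        proof -
          consider "Im w = - \<tau> * Re w" | "Im w = \<tau> * Re w"
            using w by linarith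
          then show ?thesis
          proof cases
            \<comment> \<open>lower edge: \<open>u w\<close> is real\<close>
            case 1
            then have im: "Im (u * w) = 0" by (simp add: u_def)
            then have "u * w = of_real (Re (u * w))"
              by (simp add: complex_eq_iff)
            then have "cmod (F (u * w)) \<le> A * exp (- pi * \<beta> * (Re (u * w))\<^sup>2)"
              using decay by metis
            then show ?thesis
              unfolding cmod_G im by (simp add: exp_minus field_simps)
          next
            case 2
            define r where "r = Re w"
            have x: "Re (u * w) = r * (1 - \<tau>\<^sup>2)" and y: "Im (u * w) = 2 * \<tau> * r"
              using 2 by (simp_all add: u_def r_def power2_eq_square algebra_simps)
            have "cmod (G w) \<le> A * exp (pi * a * (Im (u*w))\<^sup>2) * exp (pi * (\<beta> * ((Re (u*w))\<^sup>2 - (Im (u*w))\<^sup>2) + 2 * t * Re (u*w) * Im (u*w)))"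
              unfolding cmod_G by (intro mult_right_mono growth) simp
            also have "\<dots> = A * exp (pi * (r\<^sup>2 * E \<tau>))"
              unfolding x y E_def by (simp add: power2_eq_square algebra_simps flip: exp_add)
            also have "\<dots> \<le> A"
              using \<tau>(1) A by (simp add: mult_nonneg_nonpos)
            finally show ?thesis .
          qed
        qed
        show "z / u \<in> sector \<tau>"
        proof -
          have pos: "0 < 1 + \<tau>\<^sup>2" by (simp add: add_pos_nonneg)
          have re: "Re (z / u) = (Re z + \<tau> * Im z) / (1 + \<tau>\<^sup>2)" and im: "Im (z / u) = (Im z - \<tau> * Re z) / (1 + \<tau>\<^sup>2)"
            by (simp_all add: u_def Re_divide Im_divide power2_eq_square algebra_simps)
          have "Im z - \<tau> * Re z \<le> \<tau> * (Re z + \<tau> * Im z)"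
            using \<tau>(2) by (simp add: power2_eq_square algebra_simps)
          moreover have "\<tau> * Re z - Im z \<le> \<tau> * (Re z + \<tau> * Im z)"
            using \<tau> z by (simp add: algebra_simps add_nonneg_nonneg)
          ultimately have "\<bar>Im z - \<tau> * Re z\<bar> \<le> \<tau> * (Re z + \<tau> * Im z)" by linarith
          then show ?thesis
            unfolding sector_def mem_Collect_eq re im using pos
            by (simp add: abs_divide divide_right_mono)
        qed
      qed
      moreover have "c \<le> A * exp (- pi * X)" if "c * exp (pi * X) \<le> A" for c X :: real
        using that by (simp add: exp_minus field_simps)
      ultimately show ?thesis
        unfolding cmod_G using u by simp
    qed
    have "((\<lambda>t. A * exp (- pi * (\<beta> * ((Re z)\<^sup>2 - (Im z)\<^sup>2) + 2 * t * Re z * Im z))) \<longlongrightarrow> 0) at_top"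
      using z A by real_asymp
    then have "cmod (F z) \<le> 0"
      by (rule tendsto_lowerbound) (use bound in simp_all)
    then show ?thesis by simp
  qed
  show ?thesis
  proof (rule analytic_continuation_open[of "{z. 0 < Re z} \<inter> {z. 0 < Im z}" UNIV F "\<lambda>_. 0"])
    show "open ({z. 0 < Re z} \<inter> {z. 0 < Im z})"
      by (intro open_Int open_halfspace_Re_gt open_halfspace_Im_gt)
    have "Complex 1 1 \<in> {z. 0 < Re z} \<inter> {z. 0 < Im z}"
      by simp
    then show "{z. 0 < Re z} \<inter> {z. 0 < Im z} \<noteq> {}"
      by blast
  qed (use hol quadrant in auto)
qed

section \<open>Hardy's theorem for Fourier transforms along a function\<close>

text \<open>
  Expand the exponential and integrate term by term. The partial sums of the absolute values are at
  most \<open>\<bar>G\<bar> (exp (\<bar>z\<bar> \<phi>) + exp (- \<bar>z\<bar> \<phi>))\<close>, which is integrable, so the resulting power series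
  converges for every \<open>z\<close>.
\<close>

lemma bilateral_Laplace_entire:
  fixes G :: "'a \<Rightarrow> complex" and \<phi> :: "'a \<Rightarrow> real"
  assumes [measurable]: "G \<in> borel_measurable M" "\<phi> \<in> borel_measurable M"
    and int: "\<And>y :: real. integrable M (\<lambda>x. cmod (G x) * exp (y * \<phi> x))"
  shows "(\<lambda>z. \<integral>x. G x * exp (z * of_real (\<phi> x)) \<partial>M) holomorphic_on UNIV"
proof -
  define a where "a = (\<lambda>n::nat. \<integral>x. G x * (of_real (\<phi> x) ^ n / fact n) \<partial>M)"
  have "(\<lambda>n. a n * z ^ n) sums (\<integral>x. G x * exp (z * of_real (\<phi> x)) \<partial>M)" for z
  proof -
    define f where "f = (\<lambda>n x. G x * ((z * of_real (\<phi> x)) ^ n / fact n))"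
    define D where "D = (\<lambda>x. cmod (G x) * exp (cmod z * \<phi> x) + cmod (G x) * exp (- cmod z * \<phi> x))"
    have D: "integrable M D"
      unfolding D_def by (intro Bochner_Integration.integrable_add int)
    have norm_f: "norm (f n x) = cmod (G x) * ((cmod z * \<bar>\<phi> x\<bar>) ^ n / fact n)" for n x
      by (simp add: f_def norm_mult norm_divide norm_power)
    have sums_norm: "(\<lambda>n. norm (f n x)) sums (cmod (G x) * exp (cmod z * \<bar>\<phi> x\<bar>))" for x
      unfolding norm_f
      using sums_mult[OF exp_converges[of "cmod z * \<bar>\<phi> x\<bar>"], of "cmod (G x)"]
      by (simp add: divide_inverse mult.commute)
    have sums_f: "(\<lambda>n. f n x) sums (G x * exp (z * of_real (\<phi> x)))" for x
      unfolding f_def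
      using sums_mult[OF exp_converges[of "z * of_real (\<phi> x)"], of "G x"]
      by (simp add: scaleR_conv_of_real divide_inverse mult.commute)
    have le_D: "cmod (G x) * exp (cmod z * \<bar>\<phi> x\<bar>) \<le> D x" for x
      by (cases "0 \<le> \<phi> x") (simp_all add: D_def)
    have part: "(\<Sum>n<N. norm (f n x)) \<le> D x" for N x
      using sum_le_suminf[OF sums_summable[OF sums_norm[of x]], of "{..<N}"] sums_unique[OF sums_norm[of x]] le_D[of x]
      by simp
    have int_f: "integrable M (f n)" for n
    proof (rule Bochner_Integration.integrable_bound[OF D])
      show "f n \<in> borel_measurable M" unfolding f_def by measurable
      show "AE x in M. norm (f n x) \<le> norm (D x)"
      proof (intro AE_I2)
        fix x
        have "norm (f n x) \<le> (\<Sum>m<Suc n. norm (f m x))"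
          by (intro member_le_sum) auto
        then show "norm (f n x) \<le> norm (D x)"
          using part[where N = "Suc n" and x = x] by (simp only: real_norm_def)
      qed
    qed
    have "(\<lambda>n. integral\<^sup>L M (f n)) sums (\<integral>x. (\<Sum>n. f n x) \<partial>M)"
    proof (rule sums_integral[OF int_f])
      show "AE x in M. summable (\<lambda>n. norm (f n x))"
        using sums_norm sums_summable by blast
      show "summable (\<lambda>n. \<integral>x. norm (f n x) \<partial>M)"
      proof (rule summableI_nonneg_bounded)
        fix N
        have "(\<Sum>n<N. \<integral>x. norm (f n x) \<partial>M) = (\<integral>x. (\<Sum>n<N. norm (f n x)) \<partial>M)"
          by (intro Bochner_Integration.integral_sum[symmetric] integrable_norm int_f)
        also have "\<dots> \<le> integral\<^sup>L M D"
          by (intro integral_mono D part Bochner_Integration.integrable_sum integrable_norm int_f)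
        finally show "(\<Sum>n<N. \<integral>x. norm (f n x) \<partial>M) \<le> integral\<^sup>L M D" .
      qed simp
    qed
    moreover have "integral\<^sup>L M (f n) = a n * z ^ n" for n
    proof -
      have "integral\<^sup>L M (f n) = (\<integral>x. (G x * (of_real (\<phi> x) ^ n / fact n)) * z ^ n \<partial>M)"
        unfolding f_def by (intro Bochner_Integration.integral_cong) (simp_all add: power_mult_distrib)
      also have "\<dots> = a n * z ^ n"
        unfolding a_def by simp
      finally show ?thesis .
    qed
    ultimately show ?thesis
      by (simp add: sums_unique[OF sums_f, symmetric])
  qed
  then have "(\<lambda>z. \<integral>x. G x * exp (z * of_real (\<phi> x)) \<partial>M) holomorphic_on ball 0 r" for r
    by (intro power_series_holomorphic[where a = a]) simp
  then have "(\<lambda>z. \<integral>x. G x * exp (z * of_real (\<phi> x)) \<partial>M) holomorphic_on (\<Union>r. ball 0 r)"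
    by (intro holomorphic_on_UN_open) auto
  moreover have "(\<Union>r. ball 0 r) = (UNIV :: complex set)"
    by (auto simp: gt_ex)
  ultimately show ?thesis by simp
qed

text \<open>
  Hardy's theorem for the transform of a density along a function \<open>\<phi>\<close> on an arbitrary measure space.
  Taking \<open>\<phi>\<close> to be a coordinate on a product space spares integrating out the other coordinates.
\<close>

lemma Hardy_uniqueness:
  fixes G :: "'a \<Rightarrow> complex" and \<phi> :: "'a \<Rightarrow> real"
  assumes [measurable]: "G \<in> borel_measurable M" "\<phi> \<in> borel_measurable M"
    and int: "\<And>y. integrable M (\<lambda>x. cmod (G x) * exp (2 * pi * y * \<phi> x))"
    and growth: "\<And>y. (\<integral>x. cmod (G x) * exp (2 * pi * y * \<phi> x) \<partial>M) \<le> A * exp (pi * a * y\<^sup>2)"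
    and decay: "AE s in lborel. cmod (\<integral>x. G x * exp (- 2 * pi * \<i> * of_real (s * \<phi> x)) \<partial>M) \<le> C * exp (- pi * \<beta> * s\<^sup>2)"
    and ab: "a < \<beta>"
  shows "(\<integral>x. G x * exp (- 2 * pi * \<i> * of_real (s * \<phi> x)) \<partial>M) = 0"
proof -
  define F where "F = (\<lambda>z. \<integral>x. G x * exp (- 2 * pi * \<i> * z * of_real (\<phi> x)) \<partial>M)"
  have "((\<lambda>z. \<integral>x. G x * exp (z * of_real (\<phi> x)) \<partial>M) \<circ> (\<lambda>z. - 2 * pi * \<i> * z)) holomorphic_on UNIV"
  proof (intro holomorphic_on_compose holomorphic_intros holomorphic_on_subset[OF bilateral_Laplace_entire])
    show "integrable M (\<lambda>x. cmod (G x) * exp (y * \<phi> x))" for y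
      using int[of "y / (2 * pi)"] by simp
  qed auto
  then have hol: "F holomorphic_on UNIV"
    by (simp add: F_def o_def)
  have F_real: "F (of_real s) = (\<integral>x. G x * exp (- 2 * pi * \<i> * of_real (s * \<phi> x)) \<partial>M)" for s
    unfolding F_def by (simp add: mult.assoc)
  define A' where "A' = max 1 (max A C)"
  have "continuous_on UNIV F"
    using hol holomorphic_on_imp_continuous_on by blast
  then have cont: "continuous_on UNIV (\<lambda>s::real. F (of_real s))"
    by (auto intro: continuous_on_compose2 continuous_intros)
  have "F (of_real s) = 0"
  proof (rule entire_gaussian_decay_eq_0[OF hol ab])
    show "0 < A'" by (simp add: A'_def)
    show "cmod (F z) \<le> A' * exp (pi * a * (Im z)\<^sup>2)" for z
    proof -
      have "cmod (F z) \<le> (\<integral>x. cmod (G x * exp (- 2 * pi * \<i> * z * of_real (\<phi> x))) \<partial>M)"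
        unfolding F_def by (rule integral_norm_bound)
      also have "\<dots> = (\<integral>x. cmod (G x) * exp (2 * pi * Im z * \<phi> x) \<partial>M)"
        by (simp add: norm_mult norm_exp_eq_Re mult.assoc)
      also have "\<dots> \<le> A * exp (pi * a * (Im z)\<^sup>2)"
        by (rule growth)
      also have "\<dots> \<le> A' * exp (pi * a * (Im z)\<^sup>2)"
        by (intro mult_right_mono) (auto simp: A'_def)
      finally show ?thesis .
    qed
    show "cmod (F (of_real s)) \<le> A' * exp (- pi * \<beta> * s\<^sup>2)" for s
    proof -
      \<comment> \<open>the bound holds almost everywhere and \<open>F\<close> is continuous, so it holds everywhere\<close>
      have "closed {s. cmod (F (of_real s)) \<le> C * exp (- pi * \<beta> * s\<^sup>2)}"
        by (intro closed_Collect_le continuous_intros cont)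
      moreover have "AE s in lebesgue. s \<in> {s. cmod (F (of_real s)) \<le> C * exp (- pi * \<beta> * s\<^sup>2)}"
        using AE_completion[OF decay] by (simp add: F_real)
      ultimately have "cmod (F (of_real s)) \<le> C * exp (- pi * \<beta> * s\<^sup>2)"
        using mem_closed_if_AE_lebesgue by blast
      also have "\<dots> \<le> A' * exp (- pi * \<beta> * s\<^sup>2)"
        by (intro mult_right_mono) (auto simp: A'_def)
      finally show ?thesis .
    qed
  qed
  then show ?thesis by (simp add: F_real)
qed

section \<open>Gaussian integrals\<close>

text \<open>
  Completing the square gives a multiple of the normal density with mean \<open>y / \<alpha>\<close> and variance
  \<open>1 / (2 \<pi> \<alpha>)\<close>.
\<close>

lemma gaussian_exp_linear:
  assumes "0 < \<alpha>"
  shows "integrable lborel (\<lambda>t::real. exp (- pi * \<alpha> * t\<^sup>2 + 2 * pi * y * t))" (is ?int)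
    and "(\<integral>t. exp (- pi * \<alpha> * t\<^sup>2 + 2 * pi * y * t) \<partial>lborel) = exp (pi / \<alpha> * y\<^sup>2) / sqrt \<alpha>" (is ?val)
proof -
  define \<sigma> where "\<sigma> = 1 / sqrt (2 * pi * \<alpha>)"
  have \<sigma>: "0 < \<sigma>" "\<sigma>\<^sup>2 = 1 / (2 * pi * \<alpha>)"
    using assms by (simp_all add: \<sigma>_def power_divide)
  have eq: "exp (- pi * \<alpha> * t\<^sup>2 + 2 * pi * y * t) =
      (exp (pi / \<alpha> * y\<^sup>2) / sqrt \<alpha>) * normal_density (y / \<alpha>) \<sigma> t" for t
  proof -
    have "normal_density (y / \<alpha>) \<sigma> t = sqrt \<alpha> * exp (- (t - y / \<alpha>)\<^sup>2 * (pi * \<alpha>))"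
      unfolding normal_density_def \<sigma>(2) using assms by (simp add: real_sqrt_divide)
    moreover have "- pi * \<alpha> * t\<^sup>2 + 2 * pi * y * t = pi / \<alpha> * y\<^sup>2 + (- (t - y / \<alpha>)\<^sup>2 * (pi * \<alpha>))"
      using assms by (simp add: field_simps power2_eq_square)
    ultimately show ?thesis
      using assms by (simp only: exp_add) simp
  qed
  show ?int ?val
    unfolding eq using integrable_normal_density[OF \<sigma>(1)] integral_normal_density[OF \<sigma>(1)]
    by simp_all
qed

lemma gaussian_exp_linear_PiM:
  fixes I :: "'i set"
  assumes \<alpha>: "0 < \<alpha>" and I: "finite I" "j \<in> I"
  defines "M \<equiv> Pi\<^sub>M I (\<lambda>_. lborel :: real measure)"
  shows "integrable M (\<lambda>x. exp (- pi * \<alpha> * (\<Sum>i\<in>I. (x i)\<^sup>2)) * exp (2 * pi * y * x j))" (is ?int)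
    and "(\<integral>x. exp (- pi * \<alpha> * (\<Sum>i\<in>I. (x i)\<^sup>2)) * exp (2 * pi * y * x j) \<partial>M) =
      (1 / sqrt \<alpha>) ^ card I * exp (pi / \<alpha> * y\<^sup>2)" (is ?val)
proof -
  interpret product_sigma_finite "\<lambda>_ :: 'i. lborel :: real measure" ..
  \<comment> \<open>only the factor with index \<open>j\<close> carries a linear term, so the integrand is a product\<close>
  define e where "e = (\<lambda>i. if i = j then y else 0)"
  define f where "f = (\<lambda>i (t::real). exp (- pi * \<alpha> * t\<^sup>2 + 2 * pi * e i * t))"
  have eq: "exp (- pi * \<alpha> * (\<Sum>i\<in>I. (x i)\<^sup>2)) * exp (2 * pi * y * x j) = (\<Prod>i\<in>I. f i (x i))" for x
  proof -
    have "(\<Sum>i\<in>I. 2 * pi * e i * x i) = (\<Sum>i\<in>I. if i = j then 2 * pi * y * x j else 0)"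
      by (intro sum.cong) (auto simp: e_def)
    then have "(\<Sum>i\<in>I. 2 * pi * e i * x i) = 2 * pi * y * x j"
      using I by simp
    then show ?thesis
      unfolding f_def using I
      by (simp add: exp_sum[symmetric] sum.distrib sum_subtractf sum_negf sum_distrib_left exp_add[symmetric])
  qed
  have int: "integrable lborel (f i)" for i
    unfolding f_def by (rule gaussian_exp_linear(1)[OF \<alpha>])
  show ?int
    unfolding eq M_def by (intro product_integrable_prod I int)
  have "(\<Sum>i\<in>I. pi / \<alpha> * (e i)\<^sup>2) = (\<Sum>i\<in>I. if i = j then pi / \<alpha> * y\<^sup>2 else 0)"
    by (intro sum.cong) (auto simp: e_def)
  then have e: "(\<Sum>i\<in>I. pi / \<alpha> * (e i)\<^sup>2) = pi / \<alpha> * y\<^sup>2"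
    using I by simp
  have "(\<integral>x. (\<Prod>i\<in>I. f i (x i)) \<partial>M) = (\<Prod>i\<in>I. integral\<^sup>L lborel (f i))"
    unfolding M_def by (intro product_integral_prod I int)
  also have "\<dots> = (\<Prod>i\<in>I. (1 / sqrt \<alpha>) * exp (pi / \<alpha> * (e i)\<^sup>2))"
    unfolding f_def gaussian_exp_linear(2)[OF \<alpha>] by simp
  also have "\<dots> = (1 / sqrt \<alpha>) ^ card I * exp (pi / \<alpha> * y\<^sup>2)"
    unfolding prod.distrib exp_sum[OF I(1), symmetric] e by simp
  finally show ?val
    unfolding eq .
qed

lemma integrable_gaussian_euclidean:
  assumes "0 < \<alpha>"
  shows "integrable (lborel :: 'a::euclidean_space measure) (\<lambda>x. exp (- pi * \<alpha> * (norm x)\<^sup>2))"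
proof -
  obtain j :: 'a where j: "j \<in> Basis"
    using nonempty_Basis by blast
  have "(norm x)\<^sup>2 = (\<Sum>b\<in>Basis. (x \<bullet> b)\<^sup>2)" for x :: 'a
    by (subst power2_norm_eq_inner, subst euclidean_inner) (simp add: power2_eq_square)
  then show ?thesis
    using gaussian_exp_linear_PiM(1)[OF assms finite_Basis j, of 0]
    by (subst lborel_eq) (simp add: integrable_distr_eq)
qed

section \<open>Almost everywhere statements under linear changes of variables\<close>

text \<open>
  A null set meets almost every line in direction \<open>v\<close> in a null set: every translate of it by \<open>s v\<close> is
  null, so by Fubini almost every \<open>x\<close> has \<open>x + s v\<close> outside it for almost all \<open>s\<close>. The
  reparametrization by \<open>r x\<close> allows \<open>s\<close> to be the new value of a coordinate of the point.
\<close>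

lemma AE_lborel_on_lines:
  fixes v :: "'a::euclidean_space"
  assumes "AE x in lborel. Q x"
  shows "AE x in lborel. AE s in lborel. Q (x + (s - r x) *\<^sub>R v)"
proof -
  obtain N where N: "{x. \<not> Q x} \<subseteq> N" "N \<in> null_sets lborel"
    using assms by (auto simp: eventually_ae_filter)
  then have [measurable]: "N \<in> sets borel"
    by (auto simp: null_sets_def)
  have "AE x in lborel. x + s *\<^sub>R v \<notin> N" for s
    using AE_distrD[of "(+) (s *\<^sub>R v)" lborel borel "\<lambda>x. x \<notin> N"] AE_not_in[OF N(2)]
    unfolding lborel_distr_plus by (simp add: add.commute)
  then have "AE s in lborel. AE x in lborel. x + s *\<^sub>R v \<notin> N"
    by simp
  moreover have "{w \<in> space (lborel \<Otimes>\<^sub>M lborel). fst w + snd w *\<^sub>R v \<notin> N} \<in> sets (lborel \<Otimes>\<^sub>M lborel)"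
    by measurable
  ultimately have "AE x in lborel. AE s in lborel. x + s *\<^sub>R v \<notin> N"
    using lborel_pair.AE_commute[of "\<lambda>x s. x + s *\<^sub>R v \<notin> N"] by blast
  then show ?thesis
  proof (eventually_elim)
    case (elim x)
    then have "AE s in lborel. x + (- r x + s) *\<^sub>R v \<notin> N"
      using AE_distrD[of "(+) (- r x)" lborel borel "\<lambda>s. x + s *\<^sub>R v \<notin> N"]
      unfolding lborel_distr_plus by simp
    then show ?case
      by eventually_elim (use N in auto)
  qed
qed

lemma AE_linear_substitution:
  fixes L :: "real^'n^'n"
  assumes L: "invertible L" and ae: "AE z in lborel. R (matrix_inv L *v z)"
  shows "AE y in lborel. R y"
proof -
  obtain N where N: "negligible N" "{z. \<not> R (matrix_inv L *v z)} \<subseteq> N"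
    using AE_completion[OF ae] unfolding eventually_ae_filter_negligible by blast
  have "negligible ((*v) (matrix_inv L) ` N)"
    using N(1) by (intro negligible_differentiable_image_negligible linear_imp_differentiable_on)
      (auto intro: matrix_vector_mul_linear)
  moreover have "{y. \<not> R y} \<subseteq> (*v) (matrix_inv L) ` N"
  proof
    fix y assume "y \<in> {y. \<not> R y}"
    moreover have "matrix_inv L ** L = mat 1"
      using someI_ex[OF L[unfolded invertible_def]] unfolding matrix_inv_def by blast
    then have "matrix_inv L *v (L *v y) = y"
      by (simp add: matrix_vector_mul_assoc)
    ultimately show "y \<in> (*v) (matrix_inv L) ` N"
      using N(2) by (intro image_eqI[of _ _ "L *v y"]) auto
  qed
  ultimately have "AE y in lebesgue. R y"
    unfolding eventually_ae_filter_negligible by blast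
  then show ?thesis
    by (simp add: AE_completion_iff)
qed

definition join_halves :: "real^'d::finite \<Rightarrow> real^'d \<Rightarrow> real^('d + 'd)" where
  "join_halves x y = (\<chi> i. case i of Inl p \<Rightarrow> x $ p | Inr p \<Rightarrow> y $ p)"

lemma halves_join [simp]:
  "upper_half (join_halves x (y :: real^'d::finite)) = x" "lower_half (join_halves x y) = y"
  by (simp_all add: upper_half_def lower_half_def join_halves_def vec_eq_iff)

lemma measurable_join_halves [measurable]:
  "(\<lambda>(x, y). join_halves x y :: real^('d::finite + 'd)) \<in> borel_measurable (borel \<Otimes>\<^sub>M borel)"
proof -
  have "linear (\<lambda>(x, y). join_halves x y :: real^('d + 'd))"
    by (intro linearI) (auto simp: join_halves_def vec_eq_iff split: sum.split)
  then show ?thesis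
    unfolding borel_prod
    by (intro borel_measurable_continuous_onI linear_continuous_on linear_conv_bounded_linear[THEN iffD1])
qed

lemma prod_Basis_cart:
  fixes x :: "real^'n"
  shows "(\<Prod>b\<in>Basis. f (x \<bullet> b)) = (\<Prod>i\<in>UNIV. f (x $ i))"
proof -
  have B: "(Basis :: (real^'n) set) = range (\<lambda>i. axis i 1)"
    by (auto simp: Basis_vec_def)
  have "inj (\<lambda>i. axis i 1 :: real^'n)"
    by (auto simp: inj_on_def axis_eq_axis)
  then show ?thesis
    unfolding B by (subst prod.reindex) (auto simp: inner_axis)
qed

text \<open>
  Lebesgue measure is determined by the volumes of boxes, and a box in the joint space is the product
  of its two halves.
\<close>

lemma lborel_join_halves:
  "lborel = distr (lborel \<Otimes>\<^sub>M lborel) borel (\<lambda>(x, y). join_halves x y :: real^('d::finite + 'd))"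
proof (rule lborel_eqI)
  fix l u :: "real^('d + 'd)"
  assume le: "\<And>b. b \<in> Basis \<Longrightarrow> l \<bullet> b \<le> u \<bullet> b"
  have lu: "l $ i \<le> u $ i" for i
    using le[of "axis i 1"] by (simp add: inner_axis axis_in_Basis_iff)
  have box: "(\<lambda>(x, y). join_halves x y) -` box l u =
      box (upper_half l) (upper_half u) \<times> box (lower_half l) (lower_half u)"
    by (auto simp: mem_box_cart join_halves_def upper_half_def lower_half_def split: sum.splits)
  have half: "emeasure lborel (box (h l) (h u)) = (\<Prod>i\<in>UNIV. ennreal (u $ c i - l $ c i))"
    if h: "\<And>z i. h z $ i = z $ c i" for h :: "real^('d+'d) \<Rightarrow> real^'d" and c
  proof -
    have "emeasure lborel (box (h l) (h u)) = ennreal (\<Prod>b\<in>Basis. (h u - h l) \<bullet> b)"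
      using lu by (intro emeasure_lborel_box) (auto simp: Basis_vec_def inner_axis h)
    also have "\<dots> = ennreal (\<Prod>i\<in>UNIV. u $ c i - l $ c i)"
      using prod_Basis_cart[of "\<lambda>t. t" "h u - h l"] by (simp add: h)
    finally show ?thesis
      using lu by (simp add: prod_ennreal)
  qed
  have "emeasure (distr (lborel \<Otimes>\<^sub>M lborel) borel (\<lambda>(x, y). join_halves x y)) (box l u) =
      emeasure (lborel \<Otimes>\<^sub>M lborel) (box (upper_half l) (upper_half u) \<times> box (lower_half l) (lower_half u))"
    by (subst emeasure_distr) (auto simp: box space_pair_measure)
  also have "\<dots> = emeasure lborel (box (upper_half l) (upper_half u)) * emeasure lborel (box (lower_half l) (lower_half u))"
    by (intro lborel.emeasure_pair_measure_Times) auto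
  also have "\<dots> = (\<Prod>i\<in>UNIV. ennreal (u $ Inl i - l $ Inl i)) * (\<Prod>i\<in>UNIV. ennreal (u $ Inr i - l $ Inr i))"
    using half[of upper_half Inl] half[of lower_half Inr] by (simp add: upper_half_def lower_half_def)
  also have "\<dots> = (\<Prod>i\<in>UNIV. ennreal ((u - l) $ i))"
    by (simp add: UNIV_Plus_UNIV[symmetric] prod.Plus del: UNIV_Plus_UNIV)
  also have "\<dots> = ennreal (\<Prod>i\<in>UNIV. (u - l) $ i)"
    using lu by (simp add: prod_ennreal)
  also have "(\<Prod>i\<in>UNIV. (u - l) $ i) = (\<Prod>b\<in>Basis. (u - l) \<bullet> b)"
    using prod_Basis_cart[of "\<lambda>t. t" "u - l"] by simp
  finally show "emeasure (distr (lborel \<Otimes>\<^sub>M lborel) borel (\<lambda>(x, y). join_halves x y)) (box l u) =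
      ennreal (\<Prod>b\<in>Basis. (u - l) \<bullet> b)" .
qed simp

lemma AE_halves:
  assumes "AE z in lborel. P (upper_half z) (lower_half z)"
  shows "AE x in lborel. AE y in lborel. P x y" and "AE y in lborel. AE x in lborel. P x y"
proof -
  have m: "(\<lambda>(x, y). join_halves x y :: real^('a + 'a)) \<in> lborel \<Otimes>\<^sub>M lborel \<rightarrow>\<^sub>M borel"
    by measurable
  have *: "AE w in lborel \<Otimes>\<^sub>M lborel. P (fst w) (snd w)"
    using AE_distrD[OF m, of "\<lambda>z. P (upper_half z) (lower_half z)"] assms
    unfolding lborel_join_halves[symmetric] by (simp add: case_prod_unfold)
  then show "AE x in lborel. AE y in lborel. P x y"
    using lborel_pair.AE_pair by fastforce
  have "AE w in lborel \<Otimes>\<^sub>M lborel. P (snd w) (fst w)"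
    using AE_distrD[OF measurable_pair_swap'[of lborel lborel], of "\<lambda>w. P (fst w) (snd w)"] *
    unfolding lborel_pair.distr_pair_swap[symmetric] by (simp add: case_prod_unfold)
  then show "AE y in lborel. AE x in lborel. P x y"
    using lborel_pair.AE_pair by fastforce
qed

section \<open>Hardy's theorem for the partial Fourier transform\<close>

lemma first_coords_nonempty:
  assumes "1 \<le> k"
  obtains i :: "'d::{finite,linorder}" where "i \<in> first_coords k"
proof -
  have "\<not> j < Min UNIV" for j :: 'd
    by (rule leD, rule Min_le) simp_all
  then have "{j :: 'd. j < Min UNIV} = {}"
    by blast
  then have "Min UNIV \<in> (first_coords k :: 'd set)"
    using assms unfolding first_coords_def by (simp only: mem_Collect_eq card.empty)
  then show thesis
    by (rule that)
qed

lemma measurable_fill_coords: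
  "(\<lambda>x. \<chi> i. if i \<in> I then x i else w i) \<in> borel_measurable (Pi\<^sub>M I (\<lambda>_. lborel :: real measure))"
  (is "?f \<in> _")
proof -
  have "(\<lambda>x. ?f x \<bullet> axis i 1) \<in> borel_measurable (Pi\<^sub>M I (\<lambda>_. lborel :: real measure))" for i
    by (cases "i \<in> I") (simp_all add: inner_axis)
  then show ?thesis
    by (subst borel_measurable_euclidean_space) (auto simp: Basis_vec_def)
qed

text \<open>
  On almost every line in the direction of one transformed coordinate \<open>j\<close> the decay holds for almost all
  points of the line. Along such a line the partial transform is the Fourier transform in \<open>s\<close> of a
  function \<open>G\<close> with Gaussian decay, in which the remaining frequencies enter only through a phase.
  Hardy's theorem makes it vanish on the whole line, in particular at the point that the line was
  drawn through.
\<close>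

lemma Hardy_partial_fourier_integral:
  fixes g :: "real^('d::{finite,linorder}) \<Rightarrow> complex"
  assumes g [measurable]: "g \<in> borel_measurable borel"
    and bound: "\<And>x. cmod (g x) \<le> C * exp (- pi * \<alpha> * (norm x)\<^sup>2)"
    and decay: "AE w in lborel. cmod (partial_fourier_integral k g w) \<le> D * exp (- pi * \<beta> * (norm w)\<^sup>2)"
    and k: "1 \<le> k" and pos: "0 < \<alpha>" "0 < \<beta>" "1 < \<alpha> * \<beta>"
  shows "AE w in lborel. partial_fourier_integral k g w = 0"
proof -
  define I :: "'d set" where "I = first_coords k"
  define M where "M = Pi\<^sub>M I (\<lambda>_. lborel :: real measure)"
  obtain j where j: "j \<in> I"
    using first_coords_nonempty[OF k] unfolding I_def by blast
  have C: "0 \<le> C"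
    using order_trans[OF norm_ge_zero bound[of 0]] by simp
  have "AE w in lborel. AE s in lborel.
      cmod (partial_fourier_integral k g (w + (s - w $ j) *\<^sub>R axis j 1)) \<le>
      D * exp (- pi * \<beta> * (norm (w + (s - w $ j) *\<^sub>R axis j 1))\<^sup>2)"
    by (rule AE_lborel_on_lines[OF decay])
  then show ?thesis
  proof eventually_elim
    case (elim w)
    define fill where "fill = (\<lambda>x. \<chi> i. if i \<in> I then x i else w $ i)"
    define G where "G = (\<lambda>x. g (fill x) *
      exp (- 2 * pi * \<i> * complex_of_real (\<Sum>i\<in>I - {j}. w $ i * x i)))"
    have [measurable]: "fill \<in> borel_measurable M"
      unfolding fill_def M_def by (rule measurable_fill_coords)
    have [measurable]: "(\<lambda>x. x i) \<in> borel_measurable M" if "i \<in> I" for i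
      using that unfolding M_def by measurable
    have G_meas [measurable]: "G \<in> borel_measurable M"
      unfolding G_def by measurable
    have j_meas: "(\<lambda>x. x j) \<in> borel_measurable M"
      using j by measurable
    have slice: "partial_fourier_integral k g (w + (s - w $ j) *\<^sub>R axis j 1) =
        (\<integral>x. G x * exp (- 2 * pi * \<i> * of_real (s * x j)) \<partial>M)" for s
      unfolding partial_fourier_integral_def M_def I_def[symmetric]
    proof (intro Bochner_Integration.integral_cong refl)
      fix x
      let ?w = "w + (s - w $ j) *\<^sub>R axis j 1"
      have "(\<chi> i. if i \<in> I then x i else ?w $ i) = fill x"
        using j by (auto simp: fill_def vec_eq_iff axis_def)
      moreover have "(\<Sum>i\<in>I. ?w $ i * x i) = s * x j + (\<Sum>i\<in>I - {j}. w $ i * x i)"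
        using j by (subst sum.remove[of _ j]) (auto simp: axis_def intro!: sum.cong)
      ultimately show "g (\<chi> i. if i \<in> I then x i else ?w $ i) *
          exp (- 2 * pi * \<i> * complex_of_real (\<Sum>i\<in>I. ?w $ i * x i)) =
          G x * exp (- 2 * pi * \<i> * of_real (s * x j))"
        unfolding G_def by (simp add: algebra_simps exp_add[symmetric])
    qed
    have G_bound: "cmod (G x) \<le> C * exp (- pi * \<alpha> * (\<Sum>i\<in>I. (x i)\<^sup>2))" for x
    proof -
      have "(\<Sum>i\<in>I. (x i)\<^sup>2) = (\<Sum>i\<in>I. (fill x $ i)\<^sup>2)"
        by (simp add: fill_def)
      also have "\<dots> \<le> (\<Sum>i\<in>UNIV. (fill x $ i)\<^sup>2)"
        by (intro sum_mono2) auto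
      also have "\<dots> = (norm (fill x))\<^sup>2"
        unfolding power2_norm_eq_inner inner_vec_def by (simp add: power2_eq_square)
      finally have "C * exp (- pi * \<alpha> * (norm (fill x))\<^sup>2) \<le> C * exp (- pi * \<alpha> * (\<Sum>i\<in>I. (x i)\<^sup>2))"
        using C pos by (intro mult_left_mono) auto
      moreover have "cmod (G x) = cmod (g (fill x))"
        by (simp add: G_def norm_mult norm_exp_eq_Re)
      ultimately show ?thesis
        using bound[of "fill x"] by linarith
    qed
    note gauss = gaussian_exp_linear_PiM[OF pos(1) finite[of I] j, folded M_def]
    have dom: "integrable M (\<lambda>x. C * (exp (- pi * \<alpha> * (\<Sum>i\<in>I. (x i)\<^sup>2)) * exp (2 * pi * y * x j)))" for y
      by (intro integrable_mult_right gauss)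
    have le: "cmod (G x) * exp (2 * pi * y * x j) \<le>
        C * (exp (- pi * \<alpha> * (\<Sum>i\<in>I. (x i)\<^sup>2)) * exp (2 * pi * y * x j))" for x y
      using mult_right_mono[OF G_bound[of x], of "exp (2 * pi * y * x j)"] by (simp add: mult.assoc)
    have int: "integrable M (\<lambda>x. cmod (G x) * exp (2 * pi * y * x j))" for y
    proof (rule Bochner_Integration.integrable_bound[OF dom[of y]])
      show "(\<lambda>x. cmod (G x) * exp (2 * pi * y * x j)) \<in> borel_measurable M"
        using j_meas by measurable
      show "AE x in M. norm (cmod (G x) * exp (2 * pi * y * x j)) \<le>
          norm (C * (exp (- pi * \<alpha> * (\<Sum>i\<in>I. (x i)\<^sup>2)) * exp (2 * pi * y * x j)))"
        using le C by (intro AE_I2) simp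
    qed
    have "(\<integral>x. G x * exp (- 2 * pi * \<i> * of_real (w $ j * x j)) \<partial>M) = 0"
    proof (rule Hardy_uniqueness[OF G_meas j_meas int])
      show "(\<integral>x. cmod (G x) * exp (2 * pi * y * x j) \<partial>M) \<le>
          C * (1 / sqrt \<alpha>) ^ card I * exp (pi * (1 / \<alpha>) * y\<^sup>2)" for y
        using integral_mono[OF int[of y] dom[of y] le] gauss(2)[of y] by simp
      show "1 / \<alpha> < \<beta>"
        using pos by (simp add: pos_divide_less_eq mult.commute)
      \<comment> \<open>otherwise the decay bound would be negative on a set of full measure\<close>
      have D: "0 \<le> D"
      proof (rule ccontr)
        assume "\<not> 0 \<le> D"
        then have neg: "D * exp t < 0" for t
          by (simp add: mult_neg_pos)
        have "AE s in (lborel :: real measure). False"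
          using elim by (rule eventually_mono) (meson norm_ge_zero order_trans neg not_less)
        then have "ae_filter (lborel :: real measure) = bot"
          by (simp only: eventually_False)
        then show False
          by (simp add: ae_filter_eq_bot_iff emeasure_lborel_UNIV)
      qed
      show "AE s in lborel. cmod (\<integral>x. G x * exp (- 2 * pi * \<i> * of_real (s * x j)) \<partial>M) \<le>
          D * exp (- pi * \<beta> * s\<^sup>2)"
        using elim
      proof eventually_elim
        case (elim s)
        have "(w + (s - w $ j) *\<^sub>R axis j 1) $ j = s"
          by simp
        then have "\<bar>s\<bar> \<le> norm (w + (s - w $ j) *\<^sub>R axis j 1)"
          using component_le_norm_cart by metis
        then have "s\<^sup>2 \<le> (norm (w + (s - w $ j) *\<^sub>R axis j 1))\<^sup>2"
          using power_mono[of "\<bar>s\<bar>" _ 2] by simp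
        then have "D * exp (- pi * \<beta> * (norm (w + (s - w $ j) *\<^sub>R axis j 1))\<^sup>2) \<le> D * exp (- pi * \<beta> * s\<^sup>2)"
          using D pos by (intro mult_left_mono) auto
        then show ?case
          using elim unfolding slice by linarith
      qed
    qed
    then show ?case
      using slice[of "w $ j"] by simp
  qed
qed

text \<open>
  A unitary operator preserves the norm.
\<close>

lemma unitary_on_L2_ae_zero:
  assumes T: "unitary_on_L2 T" and f: "f \<in> L2" and 0: "AE x in lborel. T f x = 0"
  shows "AE x in lborel. f x = 0"
proof -
  have "L2_inner (T f) (T f) = 0"
    unfolding L2_inner_def using 0 by (intro integral_eq_zero_AE) auto
  then have "L2_inner f f = 0"
    using T f unfolding unitary_on_L2_def by metis
  moreover have int: "integrable lborel (\<lambda>x. (cmod (f x))\<^sup>2)"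
    using f by (simp add: L2_def)
  have "L2_inner f f = of_real (\<integral>x. (cmod (f x))\<^sup>2 \<partial>lborel)"
    unfolding L2_inner_def complex_norm_square[symmetric] by (rule integral_of_real[OF int])
  ultimately have "(\<integral>x. (cmod (f x))\<^sup>2 \<partial>lborel) = 0"
    by simp
  then have "AE x in lborel. (cmod (f x))\<^sup>2 = 0"
    by (subst (asm) integral_nonneg_eq_0_iff_AE[OF int]) auto
  then show ?thesis by simp
qed

text \<open>
  Modify \<open>g\<close> on a null set so that its bound holds everywhere. The new function is integrable, so \<open>T\<close>
  acts on it by the integral formula, and \<open>T\<close> does not see the modification.
\<close>

lemma Hardy_partial_fourier:
  fixes T :: "(real^('d::{finite,linorder}) \<Rightarrow> complex) \<Rightarrow> (real^('d::{finite,linorder}) \<Rightarrow> complex)"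
  assumes T: "partial_fourier k T" and g: "g \<in> L2"
    and bound: "AE x in lborel. cmod (g x) \<le> C * exp (- pi * \<alpha> * (norm x)\<^sup>2)"
    and decay: "AE w in lborel. cmod (T g w) \<le> D * exp (- pi * \<beta> * (norm w)\<^sup>2)"
    and k: "1 \<le> k" and pos: "0 < \<alpha>" "0 < \<beta>" "1 < \<alpha> * \<beta>"
  shows "AE w in lborel. T g w = 0"
proof -
  define g\<^sub>0 where "g\<^sub>0 = (\<lambda>x. if cmod (g x) \<le> C * exp (- pi * \<alpha> * (norm x)\<^sup>2) then g x else 0)"
  \<comment> \<open>\<open>C\<close> may be negative, in which case \<open>g\<^sub>0\<close> is zero\<close>
  define C' where "C' = max C 0"
  have g_meas [measurable]: "g \<in> borel_measurable borel"
    using g by (simp add: L2_def)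
  have g\<^sub>0_meas [measurable]: "g\<^sub>0 \<in> borel_measurable borel"
    unfolding g\<^sub>0_def by measurable
  have g\<^sub>0_bound: "cmod (g\<^sub>0 x) \<le> C' * exp (- pi * \<alpha> * (norm x)\<^sup>2)" for x
  proof -
    have "C * exp (- pi * \<alpha> * (norm x)\<^sup>2) \<le> C' * exp (- pi * \<alpha> * (norm x)\<^sup>2)"
      by (intro mult_right_mono) (auto simp: C'_def)
    moreover have "0 \<le> C' * exp (- pi * \<alpha> * (norm x)\<^sup>2)"
      by (simp add: C'_def)
    ultimately show ?thesis
      unfolding g\<^sub>0_def by (smt (verit) norm_zero)
  qed
  have "integrable lborel g\<^sub>0"
  proof (rule Bochner_Integration.integrable_bound)
    show "integrable lborel (\<lambda>x :: real^('d::{finite,linorder}). C' * exp (- pi * \<alpha> * (norm x)\<^sup>2))"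
      by (intro integrable_mult_right integrable_gaussian_euclidean pos)
    show "AE x in lborel. norm (g\<^sub>0 x) \<le> norm (C' * exp (- pi * \<alpha> * (norm x)\<^sup>2))"
      using g\<^sub>0_bound order_trans[OF _ abs_ge_self] by (intro AE_I2) auto
  qed simp
  moreover have "g\<^sub>0 \<in> L2"
  proof -
    have "integrable lborel (\<lambda>x. (cmod (g\<^sub>0 x))\<^sup>2)"
    proof (rule Bochner_Integration.integrable_bound)
      show "integrable lborel (\<lambda>x. (cmod (g x))\<^sup>2)"
        using g by (simp add: L2_def)
    qed (auto simp: g\<^sub>0_def)
    then show ?thesis
      by (simp add: L2_def)
  qed
  moreover have "ae_eq g g\<^sub>0"
    using bound unfolding ae_eq_def by eventually_elim (simp add: g\<^sub>0_def)
  ultimately have "ae_eq (T g\<^sub>0) (partial_fourier_integral k g\<^sub>0)" "ae_eq (T g) (T g\<^sub>0)"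
    using T g unfolding partial_fourier_def unitary_on_L2_def by blast+
  then have eq: "AE w in lborel. T g w = partial_fourier_integral k g\<^sub>0 w"
    unfolding ae_eq_def by eventually_elim simp
  have "AE w in lborel. cmod (partial_fourier_integral k g\<^sub>0 w) \<le> D * exp (- pi * \<beta> * (norm w)\<^sup>2)"
    using eq decay by eventually_elim simp
  then have "AE w in lborel. partial_fourier_integral k g\<^sub>0 w = 0"
    by (rule Hardy_partial_fourier_integral[OF g\<^sub>0_meas g\<^sub>0_bound _ k pos])
  with eq show ?thesis
    by eventually_elim simp
qed

section \<open>The uncertainty principle for the tensor product\<close>

lemma inner_block_diag:
  fixes y :: "real^('d::finite + 'd)"
  shows "y \<bullet> (block_matrix (mat \<alpha>) 0 0 (mat \<beta>) *v y) =
    \<alpha> * (norm (upper_half y))\<^sup>2 + \<beta> * (norm (lower_half y))\<^sup>2"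
proof -
  have sum_halves: "(\<Sum>i\<in>UNIV. h i) = (\<Sum>p\<in>UNIV. h (Inl p)) + (\<Sum>p\<in>UNIV. h (Inr p))"
    for h :: "'d + 'd \<Rightarrow> real"
    by (simp add: UNIV_Plus_UNIV[symmetric] sum.Plus del: UNIV_Plus_UNIV)
  have diag: "(\<Sum>q\<in>UNIV. mat c $ p $ q * v q) = c * v p" for c :: real and p :: 'd and v
  proof -
    have "(\<Sum>q\<in>UNIV. mat c $ p $ q * v q) = (\<Sum>q\<in>UNIV. if q = p then c * v p else 0)"
      by (intro sum.cong) (auto simp: mat_def)
    then show ?thesis by simp
  qed
  have "(block_matrix (mat \<alpha>) 0 0 (mat \<beta>) *v y) $ Inl p = \<alpha> * y $ Inl p"
    "(block_matrix (mat \<alpha>) 0 0 (mat \<beta>) *v y) $ Inr p = \<beta> * y $ Inr p" for p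
    by (simp_all add: matrix_vector_mult_def block_matrix_def sum_halves diag)
  then show ?thesis
    unfolding power2_norm_eq_inner
    by (simp add: inner_vec_def sum_halves upper_half_def lower_half_def sum_distrib_left algebra_simps)
qed

theorem theorem5p7:
  fixes V :: "complex^('d::{finite,linorder})^('d::{finite,linorder})"
    and \<Omega> B :: "real^('d + 'd)^('d + 'd)"
    and RV_hat B_hat F_k :: "(real^('d::{finite,linorder}) \<Rightarrow> complex) \<Rightarrow> (real^('d::{finite,linorder}) \<Rightarrow> complex)"
    and f :: "real^('d::{finite,linorder}) \<Rightarrow> complex"
    and k :: nat
    and \<alpha> \<beta> c :: real
  assumes "unitary_matrix V"
    and "\<not> real_valued_matrix V"
    and "metaplectic (R_mat V) RV_hat"
    and "invertible \<Omega>"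
    and "1 \<le> k" and "k \<le> CARD('d)"
    and "partial_fourier k F_k"
    and "B \<in> Sp"
    and "metaplectic B B_hat"
    and "\<forall>u\<in>L2. ae_eq
           (tensor (\<lambda>x. cmod (u x)) (\<lambda>x. cmod (RV_hat u x)))
           (dilation \<Omega> (tensor (\<lambda>x. cmod (B_hat u x)) (\<lambda>x. cmod (F_k (B_hat u) x))))"
    and "f \<in> L2"
    and "\<alpha> > 0" and "\<beta> > 0" and "c > 0" and "\<alpha> * \<beta> > 1"
    and "AE z in lborel. cmod (tensor f (RV_hat f) z) \<le>
           c * exp (- pi * \<bar>(matrix_inv \<Omega> *v z) \<bullet>
             (block_matrix (mat \<alpha>) 0 0 (mat \<beta>) *v (matrix_inv \<Omega> *v z))\<bar>)"
  shows "ae_eq f (\<lambda>x. 0)"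
proof (rule ccontr)
  assume f_nonzero: "\<not> ae_eq f (\<lambda>x. 0)"
  define g where "g = B_hat f"
  define h where "h = F_k g"
  have B_hat: "unitary_on_L2 B_hat" and F_k: "unitary_on_L2 F_k"
    using assms by (simp_all add: metaplectic_def partial_fourier_def)
  have g_L2: "g \<in> L2"
    using B_hat \<open>f \<in> L2\<close> by (simp add: g_def unitary_on_L2_def)
  have g_nonzero: "\<not> (AE x in lborel. g x = 0)"
    using f_nonzero unitary_on_L2_ae_zero[OF B_hat \<open>f \<in> L2\<close>] by (auto simp: g_def ae_eq_def)
  then have h_nonzero: "\<not> (AE x in lborel. h x = 0)"
    using unitary_on_L2_ae_zero[OF F_k g_L2] by (auto simp: h_def)

  define \<kappa> where "\<kappa> = \<bar>det \<Omega>\<bar> powr (- 1 / 2)"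
  have \<kappa>: "0 < \<kappa>"
    using \<open>invertible \<Omega>\<close> by (simp add: \<kappa>_def invertible_det_nz)
  have "AE z in lborel. tensor (\<lambda>x. cmod (f x)) (\<lambda>x. cmod (RV_hat f x)) z =
      dilation \<Omega> (tensor (\<lambda>x. cmod (g x)) (\<lambda>x. cmod (h x))) z"
    using assms(10) \<open>f \<in> L2\<close> by (simp add: ae_eq_def g_def h_def)
  with assms(16) have "AE z in lborel. \<kappa> * (cmod (g (upper_half (matrix_inv \<Omega> *v z))) *
      cmod (h (lower_half (matrix_inv \<Omega> *v z)))) \<le>
      c * exp (- pi * \<bar>\<alpha> * (norm (upper_half (matrix_inv \<Omega> *v z)))\<^sup>2 +
        \<beta> * (norm (lower_half (matrix_inv \<Omega> *v z)))\<^sup>2\<bar>)"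
    by eventually_elim (simp add: tensor_def norm_mult dilation_def inner_block_diag \<kappa>_def)
  note AE_linear_substitution[OF \<open>invertible \<Omega>\<close> this]
  then have ae: "AE y in lborel. cmod (g (upper_half y)) * cmod (h (lower_half y)) \<le>
      c / \<kappa> * exp (- pi * \<alpha> * (norm (upper_half y))\<^sup>2) * exp (- pi * \<beta> * (norm (lower_half y))\<^sup>2)"
  proof eventually_elim
    case (elim y)
    have "\<bar>\<alpha> * (norm (upper_half y))\<^sup>2 + \<beta> * (norm (lower_half y))\<^sup>2\<bar> =
        \<alpha> * (norm (upper_half y))\<^sup>2 + \<beta> * (norm (lower_half y))\<^sup>2"
      using \<open>\<alpha> > 0\<close> \<open>\<beta> > 0\<close> by simp
    moreover have "exp (- pi * (\<alpha> * p + \<beta> * q)) = exp (- pi * \<alpha> * p) * exp (- pi * \<beta> * q)" for p q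
      by (simp add: algebra_simps flip: exp_add)
    ultimately show ?case
      using elim \<kappa> by (simp only:) (simp add: pos_le_divide_eq mult_ac)
  qed

  \<comment> \<open>freeze one variable at a point where the other factor of the product does not vanish\<close>
  have rearrange: "X \<le> K * q / H * p" if "X * H \<le> K * p * q" "0 < H" for X H K p q :: real
    using that by (simp add: pos_le_divide_eq mult_ac)
  have "\<exists>y. h y \<noteq> 0 \<and> (AE x in lborel. cmod (g x) * cmod (h y) \<le>
      c / \<kappa> * exp (- pi * \<alpha> * (norm x)\<^sup>2) * exp (- pi * \<beta> * (norm y)\<^sup>2))"
  proof (rule ccontr)
    assume none: "\<not> ?thesis"
    have "AE y in lborel. h y = 0"
      using AE_halves(2)[OF ae] by eventually_elim (use none in blast)
    then show False
      using h_nonzero by contradiction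
  qed
  then obtain y where y: "h y \<noteq> 0" and "AE x in lborel. cmod (g x) * cmod (h y) \<le>
      c / \<kappa> * exp (- pi * \<alpha> * (norm x)\<^sup>2) * exp (- pi * \<beta> * (norm y)\<^sup>2)"
    by blast
  from this(2) have g_decay: "AE x in lborel. cmod (g x) \<le>
      (c / \<kappa> * exp (- pi * \<beta> * (norm y)\<^sup>2) / cmod (h y)) * exp (- pi * \<alpha> * (norm x)\<^sup>2)"
    by eventually_elim (rule rearrange, use y in auto)
  have "\<exists>x. g x \<noteq> 0 \<and> (AE y in lborel. cmod (g x) * cmod (h y) \<le>
      c / \<kappa> * exp (- pi * \<alpha> * (norm x)\<^sup>2) * exp (- pi * \<beta> * (norm y)\<^sup>2))"
  proof (rule ccontr)
    assume none: "\<not> ?thesis"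
    have "AE x in lborel. g x = 0"
      using AE_halves(1)[OF ae] by eventually_elim (use none in blast)
    then show False
      using g_nonzero by contradiction
  qed
  then obtain x where x: "g x \<noteq> 0" and "AE y in lborel. cmod (g x) * cmod (h y) \<le>
      c / \<kappa> * exp (- pi * \<alpha> * (norm x)\<^sup>2) * exp (- pi * \<beta> * (norm y)\<^sup>2)"
    by blast
  from this(2) have h_decay: "AE y in lborel. cmod (F_k g y) \<le>
      (c / \<kappa> * exp (- pi * \<alpha> * (norm x)\<^sup>2) / cmod (g x)) * exp (- pi * \<beta> * (norm y)\<^sup>2)"
    unfolding h_def[symmetric]
    by eventually_elim (rule rearrange, use x in \<open>simp_all add: mult_ac\<close>)
  have "AE y in lborel. F_k g y = 0"
    by (rule Hardy_partial_fourier[OF \<open>partial_fourier k F_k\<close> g_L2 g_decay h_decay])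
       (use assms in auto)
  then show False
    using h_nonzero by (simp add: h_def)
qed

end
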